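(* Let $M\in\{2,4,\dots\}$, $p,q>0$ and $t\ge 0$. Let $\mathcal{N}$ range over all networks for the Bass model with $M$ nodes such that $p_j=p$ and $q_j=q$ for all $j\in\mathcal{M}$, where $q_j=\sum_{k\in\mathcal{M}}q_{k,j}$. Then $$\inf_{\mathcal{N}} f(t;\mathcal{N})=\inf_{\mathcal{N},\,m\in\mathcal{M}} f_m(t;\mathcal{N})=f_{M=2}^{\rm hom}(t;p,q).$$
   Context: Bass model on a network. Let $\mathcal{M}=\{1,\dots,M\}$ be a set of individuals (nodes). $X_j(t)\in\{0,1\}$ is the state of $j$ at continuous time $t\ge 0$ ($1$ = adopter, $0$ = nonadopter), with $X_j(0)=0$ for all $j$. Each node $j$ has an external influence rate $p_j>0$, and each ordered pair $(k,j)$ has an internal influence rate $q_{k,j}\ge 0$ of $k$ on $j$, with $q_{k,j}>0$ iff there is a directed edge from $k$ to $j$, and $q_{j,j}=0$; symmetry $q_{k,j}=q_{j,k}$ is not assumed. Adopters remain adopters forever, and a nonadopter $j$ adopts at rate $\lambda_j(t)=p_j+\sum_{k\in\mathcal{M}}q_{k,j}X_k(t)$; i.e. as $\Delta t\to 0$, $\mathbb{P}(X_j(t+\Delta t)=1\mid \mathbf{X}(t))$ equals $1$ if $X_j(t)=1$ and $\big(p_j+\sum_{k\in\mathcal{M}}q_{k,j}X_k(t)\big)\Delta t$ if $X_j(t)=0$, where $\mathbf{X}(t)=(X_1(t),\dots,X_M(t))$. Set $q_j:=\sum_{k\in\mathcal{M}}q_{k,j}$; it is assumed that $q_j>0$ for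 all $j$. The network need not be connected. The network is denoted $\mathcal{N}=\mathcal{N}(\mathcal{M},\{p_k\},\{q_{k,j}\})$. Adoption probability of node $j$: $f_j(t;\mathcal{N}):=\mathbb{P}(X_j(t)=1)$. Expected adoption level: $f(t;\mathcal{N}):=\frac1M\sum_{j=1}^M f_j(t;\mathcal{N})$. Two-node network: $\mathcal{N}_{M=2}^{\rm hom}(p,q)$ is the network with $\mathcal{M}=\{1,2\}$, $p_1=p_2=p$, $q_{1,2}=q_{2,1}=q$, $q_{1,1}=q_{2,2}=0$, and $f_{M=2}^{\rm hom}(t;p,q)$ is the expected adoption level on it, which is given explicitly by $f_{M=2}^{\rm hom}(t;p,q)=1-e^{-pt}\dfrac{qe^{-pt}-pe^{-qt}}{q-p}$ for $p\ne q$. *)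

theory Defs
  imports "HOL-Probability.Probability"
begin

text \<open>
  The nodes are \<open>1, \<dots>, num_nodes N\<close>; \<open>int_rate N k j\<close> is the influence rate of \<open>k\<close> on \<open>j\<close>, and
  there is an edge from \<open>k\<close> to \<open>j\<close> precisely when it is positive. The values of the rate functions
  outside the node set are irrelevant: every definition below only inspects them on \<open>nodes N\<close>.
\<close>

record bass_network =
  num_nodes :: nat
  ext_rate :: "nat \<Rightarrow> real"
  int_rate :: "nat \<Rightarrow> nat \<Rightarrow> real"

definition nodes :: "bass_network \<Rightarrow> nat set" where
  "nodes N = {1..num_nodes N}"

definition total_int_rate :: "bass_network \<Rightarrow> nat \<Rightarrow> real" where
  "total_int_rate N j = (\<Sum>k\<in>nodes N. int_rate N k j)"

definition bass_networks :: "bass_network set" where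
  "bass_networks = {N. 0 < num_nodes N
     \<and> (\<forall>j\<in>nodes N. 0 < ext_rate N j)
     \<and> (\<forall>k\<in>nodes N. \<forall>j\<in>nodes N. 0 \<le> int_rate N k j)
     \<and> (\<forall>j\<in>nodes N. int_rate N j j = 0)
     \<and> (\<forall>j\<in>nodes N. 0 < total_int_rate N j)}"

definition adoption_rate :: "bass_network \<Rightarrow> (nat \<Rightarrow> nat) \<Rightarrow> nat \<Rightarrow> real" where
  "adoption_rate N x j = ext_rate N j + (\<Sum>k\<in>nodes N. int_rate N k j * real (x k))"

definition in_state ::
    "bass_network \<Rightarrow> (nat \<Rightarrow> real \<Rightarrow> 'w \<Rightarrow> nat) \<Rightarrow> real \<Rightarrow> (nat \<Rightarrow> nat) \<Rightarrow> 'w \<Rightarrow> bool" where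
  "in_state N X t x \<omega> \<longleftrightarrow> (\<forall>k\<in>nodes N. X k t \<omega> = x k)"

text \<open>
  \<open>bass_process N \<Omega> X\<close>: the processes \<open>X j\<close> on the probability space \<open>\<Omega>\<close> form the continuous-time
  Markov chain of the Bass model on \<open>N\<close>. The last three conjuncts are

  \<^item> the Markov property with respect to the past \<open>X(r)\<close>, \<open>r \<in> R\<close>, for finite sets \<open>R\<close> of times;

  \<^item> \<open>P(X_j(t+h) = 1 | X(t) = x) = adoption_rate N x j * h + o(h)\<close> for nonadopters \<open>j\<close>;

  \<^item> nodes adopt one at a time:
    \<open>P(X_i(t+h) = X_j(t+h) = 1 | X(t) = x) = o(h)\<close> for distinct nonadopters \<open>i\<close>, \<open>j\<close>.
    The marginal rates alone would not exclude simultaneous adoptions.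

  The errors \<open>o(h)\<close> are uniform in \<open>t\<close>; with errors depending on \<open>t\<close>, one-sided limits \<open>h \<rightarrow> 0+\<close>
  would admit additional adoptions at fixed deterministic times. Conditioning is only on events of
  positive probability.
\<close>

definition bass_process ::
    "bass_network \<Rightarrow> 'w measure \<Rightarrow> (nat \<Rightarrow> real \<Rightarrow> 'w \<Rightarrow> nat) \<Rightarrow> bool" where
  "bass_process N \<Omega> X \<longleftrightarrow>
     prob_space \<Omega>
   \<and> (\<forall>j\<in>nodes N. \<forall>t\<ge>0. X j t \<in> measurable \<Omega> (count_space {0, 1}))
   \<and> (\<forall>j\<in>nodes N. \<forall>\<omega>\<in>space \<Omega>. X j 0 \<omega> = 0)
   \<and> (\<forall>j\<in>nodes N. \<forall>\<omega>\<in>space \<Omega>. \<forall>s t. 0 \<le> s \<and> s \<le> t \<and> X j s \<omega> = 1 \<longrightarrow> X j t \<omega> = 1)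
   \<and> (\<forall>R s t x y z. finite R \<and> R \<subseteq> {0..s} \<and> 0 \<le> s \<and> s \<le> t
        \<and> 0 < \<P>(\<omega> in \<Omega>. in_state N X s x \<omega> \<and> (\<forall>r\<in>R. in_state N X r (z r) \<omega>)) \<longrightarrow>
        \<P>(\<omega> in \<Omega>. in_state N X t y \<omega> \<bar>
              in_state N X s x \<omega> \<and> (\<forall>r\<in>R. in_state N X r (z r) \<omega>))
        = \<P>(\<omega> in \<Omega>. in_state N X t y \<omega> \<bar> in_state N X s x \<omega>))
   \<and> (\<forall>x. \<forall>j\<in>nodes N. x j = 0 \<longrightarrow>
        uniform_limit {t. 0 \<le> t \<and> 0 < \<P>(\<omega> in \<Omega>. in_state N X t x \<omega>)}
          (\<lambda>h t. \<P>(\<omega> in \<Omega>. X j (t + h) \<omega> = 1 \<bar> in_state N X t x \<omega>) / h)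
          (\<lambda>t. adoption_rate N x j) (at_right 0))
   \<and> (\<forall>x. \<forall>i\<in>nodes N. \<forall>j\<in>nodes N. i \<noteq> j \<and> x i = 0 \<and> x j = 0 \<longrightarrow>
        uniform_limit {t. 0 \<le> t \<and> 0 < \<P>(\<omega> in \<Omega>. in_state N X t x \<omega>)}
          (\<lambda>h t. \<P>(\<omega> in \<Omega>. X i (t + h) \<omega> = 1 \<and> X j (t + h) \<omega> = 1 \<bar> in_state N X t x \<omega>) / h)
          (\<lambda>t. 0) (at_right 0))"

definition adoption_prob :: "'w measure \<Rightarrow> (nat \<Rightarrow> real \<Rightarrow> 'w \<Rightarrow> nat) \<Rightarrow> nat \<Rightarrow> real \<Rightarrow> real" where
  "adoption_prob \<Omega> X j t = \<P>(\<omega> in \<Omega>. X j t \<omega> = 1)"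

definition adoption_level ::
    "bass_network \<Rightarrow> 'w measure \<Rightarrow> (nat \<Rightarrow> real \<Rightarrow> 'w \<Rightarrow> nat) \<Rightarrow> real \<Rightarrow> real" where
  "adoption_level N \<Omega> X t = 1 / real (num_nodes N) * (\<Sum>j\<in>nodes N. adoption_prob \<Omega> X j t)"

definition networks_with :: "nat \<Rightarrow> real \<Rightarrow> real \<Rightarrow> bass_network set" where
  "networks_with M p q = {N \<in> bass_networks. num_nodes N = M
     \<and> (\<forall>j\<in>nodes N. ext_rate N j = p \<and> total_int_rate N j = q)}"

definition two_node_network :: "real \<Rightarrow> real \<Rightarrow> bass_network" where
  "two_node_network p q =
     \<lparr>num_nodes = 2, ext_rate = (\<lambda>j. p), int_rate = (\<lambda>k j. if k = j then 0 else q)\<rparr>"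

end

theory Submission
  imports Defs
begin

text \<open>
  Write \<open>S\<^sub>I(t)\<close> for the probability that no node of the set \<open>I\<close> has adopted by time \<open>t\<close>, so that
  \<open>f\<^sub>j = 1 - S\<^sub>j\<close>. A lower bound on adoption is an upper bound on nonadoption. Averaging the adoption
  rates over the states in which \<open>I\<close> is still free of adopters gives, on a network with \<open>p\<^sub>j = p\<close> and
  \<open>q\<^sub>j = q\<close>,

  \<^item> \<open>S\<^sub>j' = - (p + q) S\<^sub>j + (\<Sum>k. q\<^sub>k\<^sub>j S\<^sub>j\<^sub>k)\<close>, since a nonadopter \<open>k\<close> withholds its share \<open>q\<^sub>k\<^sub>j\<close> from
    the maximal rate \<open>p + q\<close>;

  \<^item> \<open>S\<^sub>j\<^sub>k' \<le> - 2 p S\<^sub>j\<^sub>k\<close> for \<open>j \<noteq> k\<close>, since each of two nonadopters adopts at least at its external rate,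
    with equality if \<open>j\<close> and \<open>k\<close> influence each other with the full rate \<open>q\<close>, for then nobody else
    influences them.

  Comparison, first for \<open>S\<^sub>j\<^sub>k\<close> and then for \<open>S\<^sub>j\<close> (the weights \<open>q\<^sub>k\<^sub>j\<close> sum to \<open>q\<close>), shows that a node in
  such a mutual pair has the smallest adoption probability among all nodes of all networks with these
  rates, whatever their sizes: this is \<open>adoption_prob_mutual_pair_le\<close>. Both nodes of the two-node
  network are of this kind, and so is every node of the network on an even number of nodes that
  consists of disjoint two-node networks. Hence all of them have the same, minimal, adoption
  probability, and both infima are attained at the latter network.

  The relations above are used as statements about increments over \<open>[t, t + h]\<close>. The Bass process
  supplies its rates with errors \<open>o(h)\<close> that are uniform in \<open>t\<close>, and uniformity is what allows such
  difference inequalities to be compared directly, by taking \<open>n\<close> equal steps and letting \<open>n\<close> grow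
  (\<open>comparison_of_uniform_difference_inequalities\<close>).
\<close>

section \<open>Comparison of difference inequalities\<close>

text \<open>
  This is the comparison principle for \<open>f' \<le> - a f + b\<close> and \<open>g' \<ge> - a g + c\<close> with \<open>b \<le> c\<close>. In each
  step of length \<open>h\<close> with \<open>a h \<le> 1\<close>, the difference \<open>f - g\<close> is multiplied by \<open>1 - a h \<in> [0, 1]\<close>, lowered by
  \<open>h (c - b)\<close> and raised by at most the error \<open>2 \<eta> h\<close>; over \<open>T / h\<close> steps the errors add up to \<open>2 \<eta> T\<close>.
\<close>

lemma comparison_of_uniform_difference_inequalities:
  fixes f g b c :: "real \<Rightarrow> real"
  assumes "0 \<le> a" "0 \<le> T" "f 0 \<le> g 0"
    and bc: "\<And>t. 0 \<le> t \<Longrightarrow> b t \<le> c t"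
    and f: "\<And>e. 0 < e \<Longrightarrow> \<forall>\<^sub>F h in at_right 0. \<forall>t\<ge>0. f (t + h) \<le> (1 - a * h) * f t + h * b t + e * h"
    and g: "\<And>e. 0 < e \<Longrightarrow> \<forall>\<^sub>F h in at_right 0. \<forall>t\<ge>0. g (t + h) \<ge> (1 - a * h) * g t + h * c t - e * h"
  shows "f T \<le> g T"
proof (cases "T = 0")
  case True
  then show ?thesis using assms(3) by simp
next
  case False
  then have T: "0 < T" using assms(2) by simp
  show ?thesis
  proof (rule field_le_epsilon)
    fix e :: real assume "0 < e"
    \<comment> \<open>both hypotheses contribute an error \<open>\<eta> h\<close> per step, hence the factor 2\<close>
    define \<eta> where "\<eta> = e / (2 * T)"
    have \<eta>: "0 < \<eta>" using \<open>0 < e\<close> T by (simp add: \<eta>_def)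
    \<comment> \<open>the 1 in the denominator covers \<open>a = 0\<close>\<close>
    have "\<forall>\<^sub>F h in at_right 0. h < 1 / (a + 1)"
      using eventually_at_right_real[of 0 "1 / (a + 1)"] \<open>0 \<le> a\<close> by (simp add: eventually_mono)
    with f[OF \<eta>] g[OF \<eta>]
    have "\<forall>\<^sub>F h in at_right 0. (\<forall>t\<ge>0. f (t + h) \<le> (1 - a * h) * f t + h * b t + \<eta> * h) \<and>
       (\<forall>t\<ge>0. g (t + h) \<ge> (1 - a * h) * g t + h * c t - \<eta> * h) \<and> h < 1 / (a + 1)"
      by eventually_elim auto
    then obtain \<delta> where "0 < \<delta>" and \<delta>: "\<And>h. 0 < h \<Longrightarrow> h < \<delta> \<Longrightarrow>
        (\<forall>t\<ge>0. f (t + h) \<le> (1 - a * h) * f t + h * b t + \<eta> * h) \<and>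
       (\<forall>t\<ge>0. g (t + h) \<ge> (1 - a * h) * g t + h * c t - \<eta> * h) \<and> h < 1 / (a + 1)"
      unfolding eventually_at_right_field by blast
    obtain n :: nat where n: "T / \<delta> < real n" using reals_Archimedean2 by blast
    with T \<open>0 < \<delta>\<close> have "0 < real n" by (meson divide_pos_pos less_trans)
    define h where "h = T / real n"
    have h: "0 < h" "h < \<delta>"
      using T n \<open>0 < real n\<close> \<open>0 < \<delta>\<close> by (auto simp: h_def field_simps)
    have "a * h \<le> (a + 1) * h" using h by simp
    also have "\<dots> \<le> 1" using \<delta>[OF h] \<open>0 \<le> a\<close> by (auto simp: field_simps)
    finally have ah: "a * h \<le> 1" .
    have grid: "f (real k * h) - g (real k * h) \<le> 2 * \<eta> * (real k * h)" for k
    proof (induction k)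
      case 0
      then show ?case using assms(3) by simp
    next
      case (Suc k)
      define s where "s = real k * h"
      have s: "0 \<le> s" using h by (simp add: s_def)
      have Suc_k: "real (Suc k) * h = s + h" by (simp add: s_def algebra_simps)
      have "f (s + h) - g (s + h) \<le> (1 - a * h) * (f s - g s) + h * (b s - c s) + 2 * \<eta> * h"
        using \<delta>[OF h] s by (auto simp: algebra_simps dest!: spec[of _ s])
      also have "\<dots> \<le> (1 - a * h) * (2 * \<eta> * s) + 0 + 2 * \<eta> * h"
        using Suc.IH ah h bc[OF s] \<eta> unfolding s_def
        by (intro add_mono mult_left_mono mult_nonneg_nonpos) auto
      also have "\<dots> \<le> 1 * (2 * \<eta> * s) + 0 + 2 * \<eta> * h"
        using \<open>0 \<le> a\<close> h s \<eta> by (intro add_mono mult_right_mono) auto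
      finally show ?case unfolding Suc_k by (simp add: algebra_simps)
    qed
    have "f T - g T \<le> 2 * \<eta> * T" using grid[of n] \<open>0 < real n\<close> by (simp add: h_def)
    also have "\<dots> = e" using T by (simp add: \<eta>_def)
    finally show "f T \<le> g T + e" by simp
  qed
qed

lemma uniform_limit_sum:
  fixes f :: "'i \<Rightarrow> 'a \<Rightarrow> 'b \<Rightarrow> 'c::real_normed_vector"
  assumes "\<And>i. i \<in> I \<Longrightarrow> uniform_limit A (f i) (l i) F"
  shows "uniform_limit A (\<lambda>n x. \<Sum>i\<in>I. f i n x) (\<lambda>x. \<Sum>i\<in>I. l i x) F"
  using assms
proof (induction I rule: infinite_finite_induct)
  case (insert i I)
  then show ?case by (simp add: uniform_limit_add)
qed (simp_all add: uniform_limit_const)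

section \<open>The law of a Bass process\<close>

text \<open>
  A state is represented by a function that is undefined outside the node set, so that there are
  finitely many states and the process is in exactly one of them.
\<close>

definition states :: "bass_network \<Rightarrow> (nat \<Rightarrow> nat) set" where
  "states N = nodes N \<rightarrow>\<^sub>E {0, 1}"

lemma finite_states [simp]: "finite (states N)"
  by (simp add: states_def nodes_def finite_PiE)

lemma states_values: "x \<in> states N \<Longrightarrow> k \<in> nodes N \<Longrightarrow> x k = 0 \<or> x k = 1"
  by (auto simp: states_def PiE_def Pi_def)

locale bass_chain =
  fixes N :: bass_network and \<Omega> :: "'w measure" and X :: "nat \<Rightarrow> real \<Rightarrow> 'w \<Rightarrow> nat"
  assumes bass_process: "bass_process N \<Omega> X"
begin

sublocale prob_space \<Omega>
  using bass_process by (simp add: bass_process_def)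

definition state_prob :: "real \<Rightarrow> (nat \<Rightarrow> nat) \<Rightarrow> real" where
  "state_prob t x = \<P>(\<omega> in \<Omega>. in_state N X t x \<omega>)"

definition nonadoption_prob :: "nat set \<Rightarrow> real \<Rightarrow> real" where
  "nonadoption_prob I t = \<P>(\<omega> in \<Omega>. \<forall>i\<in>I. X i t \<omega> = 0)"

lemma finite_nodes [simp]: "finite (nodes N)"
  by (simp add: nodes_def)

lemma X_measurable:
  "j \<in> nodes N \<Longrightarrow> 0 \<le> t \<Longrightarrow> X j t \<in> measurable \<Omega> (count_space {0, 1})"
  using bass_process[unfolded bass_process_def, THEN conjunct2, THEN conjunct1] by simp

lemma X_start: "j \<in> nodes N \<Longrightarrow> \<omega> \<in> space \<Omega> \<Longrightarrow> X j 0 \<omega> = 0"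
  using bass_process[unfolded bass_process_def, THEN conjunct2, THEN conjunct2, THEN conjunct1]
  by simp

lemma X_adopter_forever:
  assumes "j \<in> nodes N" "0 \<le> s" "s \<le> t" "\<omega> \<in> space \<Omega>" "X j s \<omega> = 1"
  shows "X j t \<omega> = 1"
  using bass_process[unfolded bass_process_def, THEN conjunct2, THEN conjunct2, THEN conjunct2,
      THEN conjunct1, rule_format, of j \<omega> s t] assms
  by simp

lemma uniform_limit_adoption:
  assumes "j \<in> nodes N" "x j = 0"
  shows "uniform_limit {t. 0 \<le> t \<and> 0 < state_prob t x}
    (\<lambda>h t. \<P>(\<omega> in \<Omega>. X j (t + h) \<omega> = 1 \<bar> in_state N X t x \<omega>) / h)
    (\<lambda>t. adoption_rate N x j) (at_right 0)"
  using bass_process[unfolded bass_process_def, THEN conjunct2, THEN conjunct2, THEN conjunct2,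
      THEN conjunct2, THEN conjunct2, THEN conjunct1, THEN spec[of _ x], THEN bspec[of _ _ j]] assms
  by (simp only: state_prob_def simp_thms)

lemma uniform_limit_double_adoption:
  assumes "i \<in> nodes N" "j \<in> nodes N" "i \<noteq> j" "x i = 0" "x j = 0"
  shows "uniform_limit {t. 0 \<le> t \<and> 0 < state_prob t x}
    (\<lambda>h t. \<P>(\<omega> in \<Omega>. X i (t + h) \<omega> = 1 \<and> X j (t + h) \<omega> = 1 \<bar> in_state N X t x \<omega>) / h)
    (\<lambda>t. 0) (at_right 0)"
  using bass_process[unfolded bass_process_def, THEN conjunct2, THEN conjunct2, THEN conjunct2,
      THEN conjunct2, THEN conjunct2, THEN conjunct2, THEN spec[of _ x], THEN bspec[of _ _ i],
      THEN bspec[of _ _ j]] assms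
  by (simp only: state_prob_def simp_thms)

lemma X_event:
  assumes "j \<in> nodes N" "0 \<le> t"
  shows "{\<omega> \<in> space \<Omega>. X j t \<omega> = a} \<in> events"
proof -
  note X = X_measurable[OF assms]
  have "{\<omega> \<in> space \<Omega>. X j t \<omega> = a} = X j t -` ({a} \<inter> {0, 1}) \<inter> space \<Omega>"
    using measurable_space[OF X] by auto
  also have "\<dots> \<in> events" by (rule measurable_sets[OF X]) simp
  finally show ?thesis .
qed

lemma X_values:
  assumes "j \<in> nodes N" "0 \<le> t" "\<omega> \<in> space \<Omega>"
  shows "X j t \<omega> = 0 \<or> X j t \<omega> = 1"
  using measurable_space[OF X_measurable[OF assms(1,2)] assms(3)] by simp

lemma in_state_event:
  assumes "0 \<le> t"
  shows "{\<omega> \<in> space \<Omega>. in_state N X t x \<omega>} \<in> events"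
  unfolding in_state_def using assms by (intro sets.sets_Collect_finite_All X_event) auto

lemma none_adopted_event:
  assumes "I \<subseteq> nodes N" "0 \<le> t"
  shows "{\<omega> \<in> space \<Omega>. \<forall>i\<in>I. X i t \<omega> = 0} \<in> events"
  using assms finite_subset[OF assms(1) finite_nodes]
  by (intro sets.sets_Collect_finite_All X_event) auto

lemma some_adopted_event:
  assumes "I \<subseteq> nodes N" "0 \<le> t"
  shows "{\<omega> \<in> space \<Omega>. \<exists>i\<in>I. X i t \<omega> = 1} \<in> events"
  using assms finite_subset[OF assms(1) finite_nodes]
  by (intro sets.sets_Collect_finite_Ex X_event) auto

lemma ex1_state:
  assumes "0 \<le> t" "\<omega> \<in> space \<Omega>"
  shows "\<exists>!x\<in>states N. in_state N X t x \<omega>"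
proof (rule ex1I)
  show "restrict (\<lambda>k. X k t \<omega>) (nodes N) \<in> states N
      \<and> in_state N X t (restrict (\<lambda>k. X k t \<omega>) (nodes N)) \<omega>"
    using X_values[OF _ assms] by (auto simp: states_def in_state_def)
next
  fix y assume "y \<in> states N \<and> in_state N X t y \<omega>"
  then show "y = restrict (\<lambda>k. X k t \<omega>) (nodes N)"
    by (intro ext) (auto simp: states_def in_state_def PiE_def extensional_def)
qed

lemma prob_sum_over_states:
  assumes t: "0 \<le> t" and I: "I \<subseteq> nodes N" and Q: "{\<omega> \<in> space \<Omega>. Q \<omega>} \<in> events"
  shows "\<P>(\<omega> in \<Omega>. (\<forall>i\<in>I. X i t \<omega> = 0) \<and> Q \<omega>)
    = (\<Sum>x | x \<in> states N \<and> (\<forall>i\<in>I. x i = 0). \<P>(\<omega> in \<Omega>. Q \<omega> \<and> in_state N X t x \<omega>))"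
proof (rule prob_sum)
  show "finite {x. x \<in> states N \<and> (\<forall>i\<in>I. x i = 0)}" by simp
  show "{\<omega> \<in> space \<Omega>. Q \<omega> \<and> in_state N X t x \<omega>} \<in> events" for x
    by (intro sets.sets_Collect_conj Q in_state_event t)
  show "{\<omega> \<in> space \<Omega>. (\<forall>i\<in>I. X i t \<omega> = 0) \<and> Q \<omega>} \<in> events"
    by (intro sets.sets_Collect_conj none_adopted_event Q I t)
  show "AE \<omega> in \<Omega>. (\<forall>x\<in>{x. x \<in> states N \<and> (\<forall>i\<in>I. x i = 0)}.
          Q \<omega> \<and> in_state N X t x \<omega> \<longrightarrow> (\<forall>i\<in>I. X i t \<omega> = 0) \<and> Q \<omega>) \<and>
        ((\<forall>i\<in>I. X i t \<omega> = 0) \<and> Q \<omega> \<longrightarrow>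
          (\<exists>!x\<in>{x. x \<in> states N \<and> (\<forall>i\<in>I. x i = 0)}. Q \<omega> \<and> in_state N X t x \<omega>))"
  proof (rule AE_I2, intro conjI impI ballI)
    fix \<omega> assume \<omega>: "\<omega> \<in> space \<Omega>"
    {
      assume A: "(\<forall>i\<in>I. X i t \<omega> = 0) \<and> Q \<omega>"
      obtain x where x: "x \<in> states N" "in_state N X t x \<omega>"
        and uniq: "\<And>y. y \<in> states N \<Longrightarrow> in_state N X t y \<omega> \<Longrightarrow> y = x"
        using ex1_state[OF t \<omega>] by blast
      have "\<forall>i\<in>I. x i = 0" using A x(2) I unfolding in_state_def by (metis subsetD)
      then show "\<exists>!x\<in>{x. x \<in> states N \<and> (\<forall>i\<in>I. x i = 0)}. Q \<omega> \<and> in_state N X t x \<omega>"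
        using A x uniq by blast
    }
  qed (use I in \<open>auto simp: in_state_def\<close>)
qed

lemma nonadoption_prob_eq_sum:
  assumes "0 \<le> t" "I \<subseteq> nodes N"
  shows "nonadoption_prob I t = (\<Sum>x | x \<in> states N \<and> (\<forall>i\<in>I. x i = 0). state_prob t x)"
  using prob_sum_over_states[OF assms, of "\<lambda>_. True"]
  by (simp add: nonadoption_prob_def state_prob_def)

lemma nonadoption_prob_start: "I \<subseteq> nodes N \<Longrightarrow> nonadoption_prob I 0 = 1"
proof -
  assume "I \<subseteq> nodes N"
  then have "{\<omega> \<in> space \<Omega>. \<forall>i\<in>I. X i 0 \<omega> = 0} = space \<Omega>" using X_start by blast
  then show ?thesis by (simp add: nonadoption_prob_def prob_space)
qed

lemma adoption_prob_eq:
  assumes "j \<in> nodes N" "0 \<le> t"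
  shows "adoption_prob \<Omega> X j t = 1 - nonadoption_prob {j} t"
proof -
  have "{\<omega> \<in> space \<Omega>. X j t \<omega> = 1} = space \<Omega> - {\<omega> \<in> space \<Omega>. X j t \<omega> = 0}"
    using X_values[OF assms] by fastforce
  then show ?thesis
    using prob_compl[OF X_event[OF assms, of 0]]
    by (simp add: adoption_prob_def nonadoption_prob_def)
qed

section \<open>The loss rate of the nonadoption probability\<close>

text \<open>
  Since two adoptions in the same short interval have probability \<open>o(h)\<close>, inclusion-exclusion reduces
  the probability of some adoption in \<open>I\<close> to the sum of the single adoption probabilities. The
  induction adds one node at a time.
\<close>

lemma uniform_limit_adoption_in_set:
  assumes "I \<subseteq> nodes N" "\<forall>i\<in>I. x i = 0"
  shows "uniform_limit {t. 0 \<le> t \<and> 0 < state_prob t x}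
    (\<lambda>h t. \<P>(\<omega> in \<Omega>. \<exists>i\<in>I. X i (t + h) \<omega> = 1 \<bar> in_state N X t x \<omega>) / h)
    (\<lambda>t. \<Sum>i\<in>I. adoption_rate N x i) (at_right 0)"
  (is "uniform_limit ?T _ _ _")
proof -
  have "finite I" using finite_subset[OF assms(1) finite_nodes] .
  then show ?thesis using assms
  proof (induction I)
    case empty
    then show ?case by (simp add: cond_prob_def uniform_limit_const)
  next
    case (insert j I)
    define F where "F = (\<lambda>(B :: real \<Rightarrow> real \<Rightarrow> 'w \<Rightarrow> bool) h t.
      \<P>(\<omega> in \<Omega>. B h t \<omega> \<bar> in_state N X t x \<omega>) / h)"
    define A where "A = (\<lambda>i h t \<omega>. X i (t + h) \<omega> = 1)"
    define U where "U = (\<lambda>h t \<omega>. \<exists>i\<in>I. A i h t \<omega>)"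
    have single: "uniform_limit ?T (F (A j)) (\<lambda>t. adoption_rate N x j) (at_right 0)"
      unfolding F_def A_def using insert.prems by (intro uniform_limit_adoption) simp_all
    have rest: "uniform_limit ?T (F U) (\<lambda>t. \<Sum>i\<in>I. adoption_rate N x i) (at_right 0)"
      unfolding F_def U_def A_def using insert.prems by (intro insert.IH) simp_all
    have "uniform_limit ?T (F (\<lambda>h t \<omega>. A j h t \<omega> \<and> A i h t \<omega>)) (\<lambda>t. 0) (at_right 0)"
      if "i \<in> I" for i
      unfolding F_def A_def using insert.prems insert.hyps that
      by (intro uniform_limit_double_adoption) auto
    then have double: "uniform_limit ?T (\<lambda>h t. \<Sum>i\<in>I. F (\<lambda>h t \<omega>. A j h t \<omega> \<and> A i h t \<omega>) h t)
        (\<lambda>t. \<Sum>i\<in>I. 0) (at_right 0)"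
      by (rule uniform_limit_sum)
    have meas: "{\<omega> \<in> space \<Omega>. A i h t \<omega>} \<in> events"
      if "i \<in> insert j I" "0 < h" "t \<in> ?T" for i h t
      unfolding A_def using insert.prems that by (intro X_event) auto
    \<comment> \<open>the joint event of \<open>j\<close> and some node of \<open>I\<close> is dominated by the union bound over \<open>double\<close>\<close>
    have both: "uniform_limit ?T (F (\<lambda>h t \<omega>. A j h t \<omega> \<and> U h t \<omega>)) (\<lambda>t. 0) (at_right 0)"
    proof (rule uniform_limitI)
      fix e :: real assume "0 < e"
      from uniform_limitD[OF double this] eventually_at_right_less[of "0::real"]
      show "\<forall>\<^sub>F h in at_right 0. \<forall>t\<in>?T. dist (F (\<lambda>h t \<omega>. A j h t \<omega> \<and> U h t \<omega>) h t) 0 < e"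
      proof eventually_elim
        case (elim h)
        show ?case
        proof
          fix t assume t: "t \<in> ?T"
          note m = meas[OF _ elim(2) t] in_state_event[of t x]
          have "\<P>(\<omega> in \<Omega>. (A j h t \<omega> \<and> U h t \<omega>) \<and> in_state N X t x \<omega>)
              = prob (\<Union>i\<in>I. {\<omega> \<in> space \<Omega>. (A j h t \<omega> \<and> A i h t \<omega>) \<and> in_state N X t x \<omega>})"
            by (rule arg_cong[where f = prob]) (auto simp: U_def)
          also have "\<dots> \<le> (\<Sum>i\<in>I. \<P>(\<omega> in \<Omega>. (A j h t \<omega> \<and> A i h t \<omega>) \<and> in_state N X t x \<omega>))"
            using t insert.hyps
            by (intro finite_measure_subadditive_finite) (auto intro!: sets.sets_Collect_conj m)
          finally have "F (\<lambda>h t \<omega>. A j h t \<omega> \<and> U h t \<omega>) h t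
              \<le> (\<Sum>i\<in>I. F (\<lambda>h t \<omega>. A j h t \<omega> \<and> A i h t \<omega>) h t)"
            using elim(2) t unfolding F_def cond_prob_def
            by (simp add: sum_divide_distrib[symmetric] divide_right_mono)
          moreover have "0 \<le> F (\<lambda>h t \<omega>. A j h t \<omega> \<and> U h t \<omega>) h t"
            using elim(2) by (simp add: F_def cond_prob_def)
          ultimately show "dist (F (\<lambda>h t \<omega>. A j h t \<omega> \<and> U h t \<omega>) h t) 0 < e"
            using elim(1) t by (force simp: dist_real_def)
        qed
      qed
    qed
    have "uniform_limit ?T (\<lambda>h t. F (A j) h t + F U h t - F (\<lambda>h t \<omega>. A j h t \<omega> \<and> U h t \<omega>) h t)
       (\<lambda>t. adoption_rate N x j + (\<Sum>i\<in>I. adoption_rate N x i) - 0) (at_right 0)"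
      by (intro uniform_limit_intros single rest both)
    also have "?this \<longleftrightarrow> ?case"
    proof (rule uniform_limit_cong)
      show "\<forall>\<^sub>F h in at_right 0. \<forall>t\<in>?T.
          F (A j) h t + F U h t - F (\<lambda>h t \<omega>. A j h t \<omega> \<and> U h t \<omega>) h t
        = \<P>(\<omega> in \<Omega>. \<exists>i\<in>insert j I. X i (t + h) \<omega> = 1 \<bar> in_state N X t x \<omega>) / h"
        using eventually_at_right_less[of "0::real"]
      proof eventually_elim
        case (elim h)
        show ?case
        proof
          fix t assume t: "t \<in> ?T"
          define B where "B = {\<omega> \<in> space \<Omega>. A j h t \<omega> \<and> in_state N X t x \<omega>}"
          define C where "C = {\<omega> \<in> space \<Omega>. U h t \<omega> \<and> in_state N X t x \<omega>}"
          note m = meas[OF _ elim t] in_state_event[of t x]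
          have "B \<in> events" unfolding B_def using t by (intro sets.sets_Collect_conj m) auto
          moreover have "C \<in> events" unfolding C_def U_def using t insert.hyps
            by (intro sets.sets_Collect_conj sets.sets_Collect_finite_Ex m) auto
          ultimately have "prob (B \<union> C) = prob B + prob C - prob (B \<inter> C)"
            by (intro measure_Un3) (auto simp: fmeasurable_eq_sets)
          moreover have "B \<union> C = {\<omega> \<in> space \<Omega>. (\<exists>i\<in>insert j I. X i (t + h) \<omega> = 1) \<and> in_state N X t x \<omega>}"
            by (auto simp: B_def C_def U_def A_def)
          moreover have "B \<inter> C = {\<omega> \<in> space \<Omega>. (A j h t \<omega> \<and> U h t \<omega>) \<and> in_state N X t x \<omega>}"
            by (auto simp: B_def C_def)
          ultimately show "F (A j) h t + F U h t - F (\<lambda>h t \<omega>. A j h t \<omega> \<and> U h t \<omega>) h t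
            = \<P>(\<omega> in \<Omega>. \<exists>i\<in>insert j I. X i (t + h) \<omega> = 1 \<bar> in_state N X t x \<omega>) / h"
            by (simp add: F_def cond_prob_def B_def C_def add_divide_distrib diff_divide_distrib)
        qed
      qed
    qed (use insert.hyps in simp)
    finally show ?case .
  qed
qed

text \<open>
  This is minus the derivative of the nonadoption probability of \<open>I\<close>: the probability flowing per unit
  of time out of the states in which \<open>I\<close> is free of adopters.
\<close>

definition nonadoption_loss_rate :: "nat set \<Rightarrow> real \<Rightarrow> real" where
  "nonadoption_loss_rate I t = (\<Sum>x | x \<in> states N \<and> (\<forall>i\<in>I. x i = 0).
     (\<Sum>i\<in>I. adoption_rate N x i) * state_prob t x)"

lemma nonadoption_prob_diff:
  assumes "I \<subseteq> nodes N" "0 \<le> t" "0 < h"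
  shows "nonadoption_prob I t - nonadoption_prob I (t + h) =
    (\<Sum>x | x \<in> states N \<and> (\<forall>i\<in>I. x i = 0).
       \<P>(\<omega> in \<Omega>. (\<exists>i\<in>I. X i (t + h) \<omega> = 1) \<and> in_state N X t x \<omega>))"
proof -
  define A where "A s = {\<omega> \<in> space \<Omega>. \<forall>i\<in>I. X i s \<omega> = 0}" for s
  have "A (t + h) \<subseteq> A t"
  proof
    fix \<omega> assume "\<omega> \<in> A (t + h)"
    then show "\<omega> \<in> A t"
      using X_adopter_forever[of _ t "t + h" \<omega>] X_values[of _ t \<omega>] assms by (force simp: A_def)
  qed
  then have "nonadoption_prob I t - nonadoption_prob I (t + h) = prob (A t - A (t + h))"
    using assms none_adopted_event unfolding nonadoption_prob_def A_def
    by (subst finite_measure_Diff) auto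
  also have "A t - A (t + h) =
      {\<omega> \<in> space \<Omega>. (\<forall>i\<in>I. X i t \<omega> = 0) \<and> (\<exists>i\<in>I. X i (t + h) \<omega> = 1)}"
    using X_values[of _ "t + h"] assms by (force simp: A_def)
  also have "prob \<dots> = (\<Sum>x | x \<in> states N \<and> (\<forall>i\<in>I. x i = 0).
       \<P>(\<omega> in \<Omega>. (\<exists>i\<in>I. X i (t + h) \<omega> = 1) \<and> in_state N X t x \<omega>))"
    using assms by (intro prob_sum_over_states some_adopted_event) auto
  finally show ?thesis .
qed

text \<open>
  Summing the conditional adoption probabilities over the finitely many states keeps the error
  uniform in \<open>t\<close>, because the state probabilities that weigh the errors sum to at most 1.
\<close>

lemma nonadoption_prob_step:
  assumes I: "I \<subseteq> nodes N" and e: "0 < e"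
  shows "\<forall>\<^sub>F h in at_right 0. \<forall>t\<ge>0.
    \<bar>nonadoption_prob I (t + h) - (nonadoption_prob I t - h * nonadoption_loss_rate I t)\<bar> \<le> e * h"
proof -
  define S where "S = {x. x \<in> states N \<and> (\<forall>i\<in>I. x i = 0)}"
  define J where "J x h t = \<P>(\<omega> in \<Omega>. (\<exists>i\<in>I. X i (t + h) \<omega> = 1) \<and> in_state N X t x \<omega>)" for x h t
  define r where "r x = (\<Sum>i\<in>I. adoption_rate N x i)" for x
  have "finite S" by (simp add: S_def)
  have "\<forall>\<^sub>F h in at_right 0. \<forall>t\<in>{t. 0 \<le> t \<and> 0 < state_prob t x}.
      dist (J x h t / state_prob t x / h) (r x) < e" if "x \<in> S" for x
    using uniform_limitD[OF uniform_limit_adoption_in_set[OF I] e] that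
    by (auto simp: S_def J_def r_def cond_prob_def state_prob_def)
  then have "\<forall>\<^sub>F h in at_right 0. \<forall>x\<in>S. \<forall>t\<in>{t. 0 \<le> t \<and> 0 < state_prob t x}.
      dist (J x h t / state_prob t x / h) (r x) < e"
    using \<open>finite S\<close> by (intro eventually_ball_finite) auto
  with eventually_at_right_less[of "0::real"] show ?thesis
  proof eventually_elim
    case (elim h)
    show ?case
    proof (intro allI impI)
      fix t :: real assume t: "0 \<le> t"
      have J: "\<bar>J x h t - h * (r x * state_prob t x)\<bar> \<le> e * h * state_prob t x" if x: "x \<in> S" for x
      \<comment> \<open>the process offers no rates when the conditioning event is null, but then nothing flows\<close>
      proof (cases "state_prob t x = 0")
        case True
        have "J x h t \<le> state_prob t x"
          unfolding J_def state_prob_def using t by (intro finite_measure_mono in_state_event) auto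
        moreover have "0 \<le> J x h t" by (simp add: J_def)
        ultimately show ?thesis using True by simp
      next
        case False
        then have pos: "0 < state_prob t x"
          using measure_nonneg[of \<Omega>] by (simp add: state_prob_def less_le)
        have "\<bar>J x h t - h * (r x * state_prob t x)\<bar>
            = \<bar>J x h t / state_prob t x / h - r x\<bar> * (h * state_prob t x)"
          using pos elim(1) by (simp add: field_simps flip: abs_mult_pos)
        also have "\<dots> \<le> e * (h * state_prob t x)"
          using elim x t pos by (intro mult_right_mono) (auto simp: dist_real_def less_imp_le)
        finally show ?thesis by (simp add: mult.assoc)
      qed
      have "\<bar>nonadoption_prob I (t + h) - (nonadoption_prob I t - h * nonadoption_loss_rate I t)\<bar>
          = \<bar>\<Sum>x\<in>S. J x h t - h * (r x * state_prob t x)\<bar>"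
        using nonadoption_prob_diff[OF I t elim(1)]
        by (simp add: J_def S_def r_def nonadoption_loss_rate_def sum_subtractf sum_distrib_left abs_minus_commute)
      also have "\<dots> \<le> (\<Sum>x\<in>S. e * h * state_prob t x)"
        by (rule order_trans[OF sum_abs sum_mono[OF J]])
      also have "\<dots> = e * h * nonadoption_prob I t"
        using nonadoption_prob_eq_sum[OF t I] by (simp add: S_def sum_distrib_left)
      also have "\<dots> \<le> e * h"
        using e elim(1) by (simp add: nonadoption_prob_def mult_left_le)
      finally show "\<bar>nonadoption_prob I (t + h) - (nonadoption_prob I t - h * nonadoption_loss_rate I t)\<bar> \<le> e * h" .
    qed
  qed
qed

text \<open>
  Writing pairs as a sum over the states free for \<open>j\<close> alone, with the indicator \<open>1 - x k\<close> of \<open>k\<close> being a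
  nonadopter, lets them be combined with the loss rate of \<open>{j}\<close>.
\<close>

lemma nonadoption_prob_pair:
  assumes "0 \<le> t" "j \<in> nodes N" "k \<in> nodes N"
  shows "nonadoption_prob {j, k} t
    = (\<Sum>x | x \<in> states N \<and> (\<forall>i\<in>{j}. x i = 0). (1 - real (x k)) * state_prob t x)"
proof -
  have "nonadoption_prob {j, k} t
      = (\<Sum>x | x \<in> states N \<and> (\<forall>i\<in>{j, k}. x i = 0). state_prob t x)"
    using assms by (intro nonadoption_prob_eq_sum) auto
  also have "\<dots> = (\<Sum>x | x \<in> states N \<and> (\<forall>i\<in>{j}. x i = 0). (1 - real (x k)) * state_prob t x)"
    using states_values[of _ N k] assms by (intro sum.mono_neutral_cong_left) auto
  finally show ?thesis .
qed

end

section \<open>Networks with equal total rates\<close>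

lemma networks_with_D:
  assumes "N \<in> networks_with M p q"
  shows "nodes N = {1..M}"
    and "j \<in> nodes N \<Longrightarrow> ext_rate N j = p"
    and "j \<in> nodes N \<Longrightarrow> (\<Sum>k\<in>nodes N. int_rate N k j) = q"
    and "j \<in> nodes N \<Longrightarrow> k \<in> nodes N \<Longrightarrow> 0 \<le> int_rate N k j"
    and "j \<in> nodes N \<Longrightarrow> int_rate N j j = 0"
  using assms by (auto simp: networks_with_def bass_networks_def total_int_rate_def nodes_def)

text \<open>
  A node that exerts the whole influence \<open>q\<close> leaves no rate to the others, since rates are
  nonnegative.
\<close>

lemma sole_influencer:
  assumes N: "N \<in> networks_with M p q" and "j \<in> nodes N" "k \<in> nodes N" "int_rate N k j = q"
  shows "(\<Sum>l\<in>nodes N. int_rate N l j * c l) = q * c k"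
proof -
  have fin: "finite (nodes N)" by (simp add: nodes_def)
  have "(\<Sum>l\<in>nodes N - {k}. int_rate N l j) = 0"
    using networks_with_D(3)[OF N assms(2)] sum.remove[OF fin assms(3), of "\<lambda>l. int_rate N l j"]
      assms(4) by simp
  then have "\<forall>l\<in>nodes N - {k}. int_rate N l j = 0"
    using fin networks_with_D(4)[OF N assms(2)] by (subst (asm) sum_nonneg_eq_0_iff) auto
  then show ?thesis
    using sum.remove[OF fin assms(3), of "\<lambda>l. int_rate N l j * c l"] assms(4) by simp
qed

locale homogeneous_bass_chain = bass_chain +
  fixes M :: nat and p q :: real
  assumes homogeneous: "N \<in> networks_with M p q"
begin

lemma adoption_rate_eq:
  "j \<in> nodes N \<Longrightarrow> adoption_rate N x j = p + (\<Sum>k\<in>nodes N. int_rate N k j * real (x k))"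
  using networks_with_D(2)[OF homogeneous] by (simp add: adoption_rate_def)

text \<open>The reason is \<open>\<lambda>\<^sub>j(x) = p + (\<Sum>k. q\<^sub>k\<^sub>j x\<^sub>k) = p + q - (\<Sum>k. q\<^sub>k\<^sub>j (1 - x\<^sub>k))\<close>.\<close>

lemma nonadoption_loss_rate_single:
  assumes "0 \<le> t" and j: "j \<in> nodes N"
  shows "nonadoption_loss_rate {j} t = (p + q) * nonadoption_prob {j} t
     - (\<Sum>k\<in>nodes N. int_rate N k j * nonadoption_prob {j, k} t)"
proof -
  let ?S = "{x. x \<in> states N \<and> (\<forall>i\<in>{j}. x i = 0)}"
  have "(\<Sum>k\<in>nodes N. int_rate N k j * nonadoption_prob {j, k} t)
     = (\<Sum>k\<in>nodes N. \<Sum>x\<in>?S. int_rate N k j * (1 - real (x k)) * state_prob t x)"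
    using assms by (simp add: nonadoption_prob_pair sum_distrib_left mult.assoc)
  also have "\<dots> = (\<Sum>x\<in>?S. (\<Sum>k\<in>nodes N. int_rate N k j * (1 - real (x k))) * state_prob t x)"
    by (subst sum.swap) (simp add: sum_distrib_right)
  also have "\<dots> = (\<Sum>x\<in>?S. (p + q) * state_prob t x - adoption_rate N x j * state_prob t x)"
    using networks_with_D(3)[OF homogeneous j]
    by (simp add: adoption_rate_eq[OF j] right_diff_distrib sum_subtractf algebra_simps)
  also have "\<dots> = (p + q) * nonadoption_prob {j} t - nonadoption_loss_rate {j} t"
    using assms by (simp add: nonadoption_prob_eq_sum nonadoption_loss_rate_def sum_subtractf sum_distrib_left)
  finally show ?thesis by simp
qed

lemma nonadoption_loss_rate_pair_ge:
  assumes "0 \<le> t" "j \<in> nodes N" "k \<in> nodes N" "j \<noteq> k"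
  shows "2 * p * nonadoption_prob {j, k} t \<le> nonadoption_loss_rate {j, k} t"
proof -
  have "p \<le> adoption_rate N x i" if "i \<in> nodes N" for x i
    unfolding adoption_rate_eq[OF that] using networks_with_D(4)[OF homogeneous that]
    by (auto intro!: sum_nonneg)
  from add_mono[OF this[OF assms(2)] this[OF assms(3)]]
  have "2 * p \<le> (\<Sum>i\<in>{j, k}. adoption_rate N x i)" for x
    using assms by simp
  then have "(\<Sum>x | x \<in> states N \<and> (\<forall>i\<in>{j, k}. x i = 0). 2 * p * state_prob t x)
      \<le> nonadoption_loss_rate {j, k} t"
    unfolding nonadoption_loss_rate_def by (intro sum_mono mult_right_mono) (simp_all add: state_prob_def)
  then show ?thesis
    using assms by (simp add: nonadoption_prob_eq_sum[of t "{j, k}"] sum_distrib_left)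
qed

lemma nonadoption_loss_rate_mutual_pair:
  assumes "0 \<le> t" "j \<in> nodes N" "k \<in> nodes N" "j \<noteq> k"
    and "int_rate N k j = q" "int_rate N j k = q"
  shows "nonadoption_loss_rate {j, k} t = 2 * p * nonadoption_prob {j, k} t"
proof -
  have "(\<Sum>i\<in>{j, k}. adoption_rate N x i) = 2 * p" if "x j = 0" "x k = 0" for x
    using assms that by (simp add: adoption_rate_eq sole_influencer[OF homogeneous])
  then have "nonadoption_loss_rate {j, k} t
      = (\<Sum>x | x \<in> states N \<and> (\<forall>i\<in>{j, k}. x i = 0). 2 * p * state_prob t x)"
    unfolding nonadoption_loss_rate_def by (intro sum.cong refl) auto
  then show ?thesis
    using assms by (simp add: nonadoption_prob_eq_sum[of t "{j, k}"] sum_distrib_left)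
qed

end

section \<open>Mutual pairs minimise adoption\<close>

text \<open>
  The two networks may have different sizes: only the totals \<open>p\<close> and \<open>q\<close> enter the inequalities for
  nonadoption, and the mutual pair satisfies them with equality.
\<close>

lemma adoption_prob_mutual_pair_le:
  assumes "homogeneous_bass_chain N \<Omega> X M p q" and j: "j \<in> nodes N"
    and "homogeneous_bass_chain N' \<Omega>' X' M' p q"
    and j': "j' \<in> nodes N'" and k': "k' \<in> nodes N'" and "j' \<noteq> k'"
    and mutual: "int_rate N' k' j' = q" "int_rate N' j' k' = q"
    and pos: "0 < p" "0 < q" and t: "0 \<le> t"
  shows "adoption_prob \<Omega>' X' j' t \<le> adoption_prob \<Omega> X j t"
proof -
  interpret A: homogeneous_bass_chain N \<Omega> X M p q by fact
  interpret B: homogeneous_bass_chain N' \<Omega>' X' M' p q by fact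
  have pair: "A.nonadoption_prob {j, k} s \<le> B.nonadoption_prob {j', k'} s"
    if k: "k \<in> nodes N" "k \<noteq> j" and s: "0 \<le> s" for k s
  proof (rule comparison_of_uniform_difference_inequalities
      [where f = "A.nonadoption_prob {j, k}" and g = "B.nonadoption_prob {j', k'}"
        and a = "2 * p" and b = "\<lambda>_. 0" and c = "\<lambda>_. 0"])
    show "0 \<le> 2 * p" "0 \<le> s" using pos s by auto
    show "A.nonadoption_prob {j, k} 0 \<le> B.nonadoption_prob {j', k'} 0"
      using j k j' k' by (simp add: A.nonadoption_prob_start B.nonadoption_prob_start)
    fix e :: real assume e: "0 < e"
    have "{j, k} \<subseteq> nodes N" using j k by simp
    from A.nonadoption_prob_step[OF this e] eventually_at_right_less[of "0::real"]
    show "\<forall>\<^sub>F h in at_right 0. \<forall>t\<ge>0. A.nonadoption_prob {j, k} (t + h)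
        \<le> (1 - 2 * p * h) * A.nonadoption_prob {j, k} t + h * 0 + e * h"
    proof eventually_elim
      case (elim h)
      show ?case
      proof (intro allI impI)
        fix t :: real assume t: "0 \<le> t"
        have "h * (2 * p * A.nonadoption_prob {j, k} t) \<le> h * A.nonadoption_loss_rate {j, k} t"
          using A.nonadoption_loss_rate_pair_ge[OF t j k(1)] k(2) elim(2) by (intro mult_left_mono) auto
        then show "A.nonadoption_prob {j, k} (t + h)
            \<le> (1 - 2 * p * h) * A.nonadoption_prob {j, k} t + h * 0 + e * h"
          using elim(1) t by (auto simp: abs_le_iff algebra_simps dest!: spec[of _ t])
      qed
    qed
    have "{j', k'} \<subseteq> nodes N'" using j' k' by simp
    from B.nonadoption_prob_step[OF this e]
    show "\<forall>\<^sub>F h in at_right 0. \<forall>t\<ge>0. B.nonadoption_prob {j', k'} (t + h)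
        \<ge> (1 - 2 * p * h) * B.nonadoption_prob {j', k'} t + h * 0 - e * h"
    proof eventually_elim
      case (elim h)
      show ?case
        using elim B.nonadoption_loss_rate_mutual_pair[OF _ j' k' \<open>j' \<noteq> k'\<close> mutual]
        by (auto simp: abs_le_iff algebra_simps)
    qed
  qed simp
  have "A.nonadoption_prob {j} t \<le> B.nonadoption_prob {j'} t"
  proof (rule comparison_of_uniform_difference_inequalities
      [where f = "A.nonadoption_prob {j}" and g = "B.nonadoption_prob {j'}" and a = "p + q"
        and b = "\<lambda>s. \<Sum>k\<in>nodes N. int_rate N k j * A.nonadoption_prob {j, k} s"
        and c = "\<lambda>s. q * B.nonadoption_prob {j', k'} s"])
    show "0 \<le> p + q" "0 \<le> t" using pos t by auto
    show "A.nonadoption_prob {j} 0 \<le> B.nonadoption_prob {j'} 0"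
      using j j' by (simp add: A.nonadoption_prob_start B.nonadoption_prob_start)
    fix e :: real assume e: "0 < e"
    from A.nonadoption_prob_step[of "{j}", OF _ e] j
    have "\<forall>\<^sub>F h in at_right 0. \<forall>t\<ge>0.
        \<bar>A.nonadoption_prob {j} (t + h) - (A.nonadoption_prob {j} t - h * A.nonadoption_loss_rate {j} t)\<bar> \<le> e * h"
      by simp
    then show "\<forall>\<^sub>F h in at_right 0. \<forall>t\<ge>0. A.nonadoption_prob {j} (t + h)
        \<le> (1 - (p + q) * h) * A.nonadoption_prob {j} t
          + h * (\<Sum>k\<in>nodes N. int_rate N k j * A.nonadoption_prob {j, k} t) + e * h"
      by eventually_elim (auto simp: abs_le_iff algebra_simps A.nonadoption_loss_rate_single[OF _ j])
    from B.nonadoption_prob_step[of "{j'}", OF _ e] j'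
    have "\<forall>\<^sub>F h in at_right 0. \<forall>t\<ge>0.
        \<bar>B.nonadoption_prob {j'} (t + h) - (B.nonadoption_prob {j'} t - h * B.nonadoption_loss_rate {j'} t)\<bar> \<le> e * h"
      by simp
    then show "\<forall>\<^sub>F h in at_right 0. \<forall>t\<ge>0. B.nonadoption_prob {j'} (t + h)
        \<ge> (1 - (p + q) * h) * B.nonadoption_prob {j'} t
          + h * (q * B.nonadoption_prob {j', k'} t) - e * h"
      by eventually_elim
        (auto simp: abs_le_iff algebra_simps B.nonadoption_loss_rate_single[OF _ j']
          sole_influencer[OF B.homogeneous j' k' mutual(1)])
  next
    fix s :: real assume s: "0 \<le> s"
    have "(\<Sum>k\<in>nodes N. int_rate N k j * A.nonadoption_prob {j, k} s)
        \<le> (\<Sum>k\<in>nodes N. int_rate N k j * B.nonadoption_prob {j', k'} s)"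
    proof (rule sum_mono)
      fix k assume k: "k \<in> nodes N"
      show "int_rate N k j * A.nonadoption_prob {j, k} s
          \<le> int_rate N k j * B.nonadoption_prob {j', k'} s"
      proof (cases "k = j")
        case True
        then show ?thesis using networks_with_D(5)[OF A.homogeneous j] by simp
      next
        case False
        then show ?thesis
          using pair[OF k False s] networks_with_D(4)[OF A.homogeneous j k]
          by (intro mult_left_mono)
      qed
    qed
    also have "\<dots> = q * B.nonadoption_prob {j', k'} s"
      using networks_with_D(3)[OF A.homogeneous j] by (simp flip: sum_distrib_right)
    finally show "(\<Sum>k\<in>nodes N. int_rate N k j * A.nonadoption_prob {j, k} s)
        \<le> q * B.nonadoption_prob {j', k'} s" .
  qed
  then show ?thesis
    using A.adoption_prob_eq[OF j t] B.adoption_prob_eq[OF j' t] by simp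
qed

section \<open>Networks of mutual pairs and the infima\<close>

definition partner :: "nat \<Rightarrow> nat" where
  "partner j = (if odd j then j + 1 else j - 1)"

text \<open>
  Nodes \<open>2 i - 1\<close> and \<open>2 i\<close> form a copy of the two-node network, for each \<open>i\<close>.
\<close>

definition matching_network :: "nat \<Rightarrow> real \<Rightarrow> real \<Rightarrow> bass_network" where
  "matching_network M p q =
     \<lparr>num_nodes = M, ext_rate = (\<lambda>j. p), int_rate = (\<lambda>k j. if k = partner j then q else 0)\<rparr>"

lemma partner:
  assumes "even M" "j \<in> {1..M}"
  shows "partner j \<in> {1..M}" "partner j \<noteq> j" "partner (partner j) = j"
proof -
  have "Suc j \<le> M" if "odd j" using that assms by (metis Suc_leI atLeastAtMost_iff le_neq_implies_less)
  then show "partner j \<in> {1..M}" using assms by (auto simp: partner_def elim!: evenE)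
qed (use assms in \<open>auto simp: partner_def\<close>)

lemma matching_network_in_networks_with:
  assumes "even M" "2 \<le> M" "0 < p" "0 < q"
  shows "matching_network M p q \<in> networks_with M p q"
proof -
  have "(\<Sum>k\<in>{1..M}. if k = partner j then q else 0) = q" if "j \<in> {1..M}" for j
    using partner(1)[OF assms(1) that] by simp
  moreover have "j \<noteq> partner j" if "j \<in> {1..M}" for j
    using partner(2)[OF assms(1) that] by simp
  ultimately show ?thesis
    using assms by (auto simp: networks_with_def bass_networks_def matching_network_def nodes_def
        total_int_rate_def)
qed

lemma two_node_network_in_networks_with:
  assumes "0 < p" "0 < q"
  shows "two_node_network p q \<in> networks_with 2 p q"
proof -
  have "{1..2::nat} = {1, 2}" by auto
  then show ?thesis
    using assms by (auto simp: networks_with_def bass_networks_def two_node_network_def nodes_def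
        total_int_rate_def)
qed

lemma adoption_level_eqI:
  assumes "N \<in> networks_with M p q" "0 < M"
    and "\<And>j. j \<in> {1..M} \<Longrightarrow> adoption_prob \<Omega> X j t = c"
  shows "adoption_level N \<Omega> X t = c"
  using assms by (simp add: adoption_level_def networks_with_def nodes_def)

lemma adoption_level_geI:
  assumes "N \<in> networks_with M p q" "0 < M"
    and "\<And>j. j \<in> {1..M} \<Longrightarrow> c \<le> adoption_prob \<Omega> X j t"
  shows "c \<le> adoption_level N \<Omega> X t"
proof -
  have "real M * c \<le> (\<Sum>j\<in>{1..M}. adoption_prob \<Omega> X j t)"
    using sum_mono[of "{1..M}" "\<lambda>_. c", OF assms(3)] by simp
  then show ?thesis
    using assms(1,2) by (simp add: adoption_level_def networks_with_def nodes_def field_simps)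
qed

theorem lemma4:
  fixes \<Omega> :: "bass_network \<Rightarrow> 'w measure"
    and X :: "bass_network \<Rightarrow> nat \<Rightarrow> real \<Rightarrow> 'w \<Rightarrow> nat"
    and M :: nat and p q t :: real
  assumes "\<And>N. N \<in> bass_networks \<Longrightarrow> bass_process N (\<Omega> N) (X N)"
    and "even M" and "2 \<le> M" and "0 < p" and "0 < q" and "0 \<le> t"
  shows "(INF N\<in>networks_with M p q. adoption_level N (\<Omega> N) (X N) t)
           = (INF (N, m)\<in>networks_with M p q \<times> {1..M}. adoption_prob (\<Omega> N) (X N) m t)
       \<and> (INF (N, m)\<in>networks_with M p q \<times> {1..M}. adoption_prob (\<Omega> N) (X N) m t)
           = adoption_level (two_node_network p q) (\<Omega> (two_node_network p q))
               (X (two_node_network p q)) t"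
proof -
  define N2 where "N2 = two_node_network p q"
  define NM where "NM = matching_network M p q"
  define f where "f N j = adoption_prob (\<Omega> N) (X N) j t" for N j
  define c where "c = f N2 1"
  have N2: "N2 \<in> networks_with 2 p q"
    using assms by (simp add: N2_def two_node_network_in_networks_with)
  have NM: "NM \<in> networks_with M p q"
    using assms by (simp add: NM_def matching_network_in_networks_with)
  have chain: "homogeneous_bass_chain N (\<Omega> N) (X N) K p q" if "N \<in> networks_with K p q" for N K
    using that assms(1)[of N]
    by (simp add: homogeneous_bass_chain_def bass_chain_def homogeneous_bass_chain_axioms_def
        networks_with_def)
  have le: "f N' j' \<le> f N j"
    if "N \<in> networks_with K p q" "j \<in> {1..K}" "N' \<in> networks_with K' p q" "j' \<in> {1..K'}"
      "k' \<in> {1..K'}" "j' \<noteq> k'" "int_rate N' k' j' = q" "int_rate N' j' k' = q"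
    for N N' K K' j j' k'
    unfolding f_def using that assms networks_with_D(1)[OF that(1)] networks_with_D(1)[OF that(3)]
    by (intro adoption_prob_mutual_pair_le[OF chain _ chain, of N K j N' K' j' k']) auto
  \<comment> \<open>in \<open>{1, 2}\<close> the other node is \<open>3 - j'\<close>\<close>
  have N2_le: "f N2 j' \<le> f N j"
    if "N \<in> networks_with K p q" "j \<in> {1..K}" "j' \<in> {1..2}" for N K j j'
  proof (rule le[OF that(1,2) N2 that(3)])
    show "3 - j' \<in> {1..2}" "j' \<noteq> 3 - j'" using that(3) by (auto, presburger)
    then show "int_rate N2 (3 - j') j' = q" "int_rate N2 j' (3 - j') = q"
      by (auto simp: N2_def two_node_network_def)
  qed
  have NM_le: "f NM j' \<le> f N j"
    if "N \<in> networks_with K p q" "j \<in> {1..K}" "j' \<in> {1..M}" for N K j j'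
    using that partner[OF assms(2) that(3)]
    by (intro le[OF that(1,2) NM, of _ "partner j'"]) (auto simp: NM_def matching_network_def)
  have c_le: "c \<le> f N j" if "N \<in> networks_with M p q" "j \<in> {1..M}" for N j
    unfolding c_def using that by (intro N2_le) auto
  have c_N2: "f N2 j = c" if "j \<in> {1..2}" for j
    unfolding c_def using that by (intro antisym N2_le[OF N2]) auto
  \<comment> \<open>both networks consist of mutual pairs, so each of them bounds the other from below\<close>
  have c_NM: "f NM j = c" if "j \<in> {1..M}" for j
  proof (rule antisym)
    show "f NM j \<le> c" unfolding c_def using that by (intro NM_le[OF N2]) auto
  qed (use c_le[OF NM that] in simp)
  have two: "adoption_level N2 (\<Omega> N2) (X N2) t = c"
    using c_N2 by (intro adoption_level_eqI[OF N2]) (auto simp: f_def)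
  have level: "(INF N\<in>networks_with M p q. adoption_level N (\<Omega> N) (X N) t) = c"
  proof (rule cInf_eq_minimum)
    have "adoption_level NM (\<Omega> NM) (X NM) t = c"
      using c_NM assms by (intro adoption_level_eqI[OF NM]) (auto simp: f_def)
    then show "c \<in> (\<lambda>N. adoption_level N (\<Omega> N) (X N) t) ` networks_with M p q"
      using NM by force
    show "c \<le> y" if "y \<in> (\<lambda>N. adoption_level N (\<Omega> N) (X N) t) ` networks_with M p q" for y
      using that c_le assms by (auto simp: f_def intro!: adoption_level_geI)
  qed
  have node: "(INF (N, m)\<in>networks_with M p q \<times> {1..M}. adoption_prob (\<Omega> N) (X N) m t) = c"
  proof (rule cInf_eq_minimum)
    have "f NM 1 = c" using assms by (intro c_NM) auto
    then show "c \<in> (\<lambda>(N, m). adoption_prob (\<Omega> N) (X N) m t) ` (networks_with M p q \<times> {1..M})"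
      using NM assms by (intro image_eqI[of _ _ "(NM, 1)"]) (auto simp: f_def)
    show "c \<le> y"
      if "y \<in> (\<lambda>(N, m). adoption_prob (\<Omega> N) (X N) m t) ` (networks_with M p q \<times> {1..M})" for y
      using that c_le by (auto simp: f_def)
  qed
  show ?thesis using level node two unfolding N2_def by simp
qed

end
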